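(* Assume that $\alpha_n/\log n \to \infty$ as $n\to\infty$. Then $$\sqrt{\frac{2 \log n}{\alpha_n}}\,\bigl(M_n - \alpha_n - b_n \sqrt{\alpha_n}\bigr)$$ converges in distribution to $G$ as $n\to\infty$, where $b_n$ is the unique solution, in the region $b_n \sim \sqrt{2 \log n}$, of the equation (in the unknown $z$) $$\log z + \frac{1}{2} \log (2 \pi) + z \sqrt{\alpha_n} - \alpha_n \log \left(1 + \frac{z}{\sqrt{\alpha_n}}\right) = \log n.$$
   Context: Let $(\alpha_n)_{n\ge 1}$ be a sequence of positive real numbers. For each $n$, let $Y_{1n},\ldots,Y_{nn}$ be i.i.d. random variables with the Gamma$(\alpha_n,1)$ distribution, i.e. with density $u^{\alpha_n-1}e^{-u}/\Gamma(\alpha_n)$ on $(0,\infty)$, and let $M_n=\max\{Y_{1n},\ldots,Y_{nn}\}$. $G$ denotes the Gumbel distribution, with distribution function $G(x)=\exp(-e^{-x})$, $x\in\mathbb R$. For sequences, $a_n\sim a_n'$ means $a_n/a_n'\to 1$ as $n\to\infty$. *)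

theory Defs
  imports "HOL-Probability.Probability" "HOL-Real_Asymp.Real_Asymp"
begin

definition gamma_density :: "real \<Rightarrow> real \<Rightarrow> real" where
  "gamma_density a u = (if 0 < u then u powr (a - 1) * exp (- u) / Gamma a else 0)"

definition gumbel :: "real measure" where
  "gumbel = interval_measure (\<lambda>x. exp (- exp (- x)))"

lemma real_distribution_gumbel: "real_distribution gumbel"
  unfolding gumbel_def
proof (rule real_distribution_interval_measure)
  show "continuous (at_right a) (\<lambda>x::real. exp (- exp (- x)))" for a
    by (intro continuous_intros)
  show "((\<lambda>x::real. exp (- exp (- x))) \<longlongrightarrow> 0) at_bot" by real_asymp
  show "((\<lambda>x::real. exp (- exp (- x))) \<longlongrightarrow> 1) at_top" by real_asymp
qed simp

lemma cdf_gumbel: "cdf gumbel x = exp (- exp (- x))"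
  unfolding cdf_def gumbel_def
proof (rule measure_interval_measure_Iic)
  show "continuous (at_right a) (\<lambda>x::real. exp (- exp (- x)))" for a
    by (intro continuous_intros)
  show "((\<lambda>x::real. exp (- exp (- x))) \<longlongrightarrow> 0) at_bot" by real_asymp
qed simp

definition centering_equation :: "real \<Rightarrow> nat \<Rightarrow> real \<Rightarrow> bool" where
  "centering_equation a n z \<longleftrightarrow>
     ln z + 1 / 2 * ln (2 * pi) + z * sqrt a - a * ln (1 + z / sqrt a) = ln (real n)"

text \<open>
  The region \<open>b n \<sim> sqrt (2 log n)\<close> constrains a sequence only asymptotically, so a solution in
  that region is required to satisfy the equation for all sufficiently large \<open>n\<close>, and is
  determined only up to finitely many terms. In particular \<open>b n > 0\<close> eventually, so both
  logarithms in the equation have positive arguments.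
\<close>
definition centering_seq :: "(nat \<Rightarrow> real) \<Rightarrow> (nat \<Rightarrow> real) \<Rightarrow> bool" where
  "centering_seq \<alpha> b \<longleftrightarrow>
     b \<sim>[sequentially] (\<lambda>n. sqrt (2 * ln (real n))) \<and>
     (\<forall>\<^sub>F n in sequentially. centering_equation (\<alpha> n) n (b n))"

end

theory Submission
  imports Defs
begin

text \<open>
  Write \<open>a = \<alpha> n\<close>, \<open>L = log n\<close>, \<open>w = a + b n * sqrt a\<close> and \<open>s = sqrt (a / (2 * L))\<close>. Since
  \<open>P (M n \<le> w + s x) = (1 - p)^n\<close> with \<open>p = P (Y > w + s x)\<close>, it suffices that \<open>n p \<rightarrow> exp (-x)\<close>.
  Substituting \<open>u = w + s v\<close> in the Gamma density, \<open>n p\<close> is a prefactor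
  \<open>n s w^(a - 1) exp (-w) / Gamma a\<close> times the integral over \<open>v > x\<close> of
  \<open>(1 + s v / w)^(a - 1) exp (-s v)\<close>. The centering equation says precisely that
  \<open>n w^a exp (-w) = a^a exp (-a) b sqrt (2 pi)\<close>, so Stirling's formula makes the prefactor tend
  to 1. As \<open>a / L \<rightarrow> \<infinity>\<close>, the exponent \<open>(a - 1) ln (1 + s v / w) - s v\<close> tends to \<open>-v\<close>, and
  \<open>ln (1 + y) \<le> y\<close> supplies an integrable majorant.
  Stirling's formula for real arguments is itself obtained by dominated convergence, from the
  substitution \<open>u = a + sqrt a * t\<close> in the density with shape \<open>a + 1\<close>.
  The left-hand side of the centering equation is increasing in \<open>z > 0\<close>, and at
  \<open>z = c sqrt (2 L)\<close> it is asymptotic to \<open>c^2 L\<close>; this gives existence and uniqueness of \<open>b\<close>.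
\<close>

subsection \<open>The rescaled Gamma density\<close>

text \<open>
  Up to a constant, the Gamma density with shape \<open>c + 1\<close> in the variable \<open>v\<close>, where
  \<open>u = w (1 + r v)\<close>.
\<close>
definition gamma_kernel :: "real \<Rightarrow> real \<Rightarrow> real \<Rightarrow> real \<Rightarrow> real" where
  "gamma_kernel c w r v = (if 0 < 1 + r * v then exp (c * ln (1 + r * v) - w * r * v) else 0)"

lemma gamma_kernel_nonneg: "0 \<le> gamma_kernel c w r v"
  by (simp add: gamma_kernel_def)

lemma borel_measurable_gamma_kernel [measurable]: "gamma_kernel c w r \<in> borel_measurable borel"
  unfolding gamma_kernel_def [abs_def] by measurable

lemma borel_measurable_gamma_density [measurable]: "gamma_density a \<in> borel_measurable borel"
  unfolding gamma_density_def [abs_def] by measurable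

lemma gamma_density_nonneg: "0 < a \<Longrightarrow> 0 \<le> gamma_density a u"
  by (simp add: gamma_density_def Gamma_real_pos less_imp_le)

text \<open>With \<open>u = w * (1 + r * v)\<close> the power and the exponential both split off
  their value at \<open>w\<close>; if \<open>1 + r * v\<close> is not positive, neither is
  \<open>u\<close>, and both sides vanish. Stirling's formula takes \<open>w = a\<close>,
  \<open>r = 1 / sqrt a\<close>; the tail estimate takes for \<open>w\<close> the centering
  point.\<close>

lemma gamma_density_affine:
  assumes "0 < w"
  shows "gamma_density a (w + w * r * v)
    = w powr (a - 1) * exp (- w) / Gamma a * gamma_kernel (a - 1) w r v"
proof -
  define u where "u = w * (1 + r * v)"
  have eq: "w + w * r * v = u" by (simp add: u_def algebra_simps)
  show ?thesis
  proof (cases "0 < 1 + r * v")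
    case True
    have "u powr (a - 1) = w powr (a - 1) * exp ((a - 1) * ln (1 + r * v))"
      using assms True by (simp add: u_def powr_mult) (simp add: powr_def)
    moreover have "exp (- u) = exp (- w) * exp (- (w * r * v))"
      by (simp add: u_def algebra_simps flip: exp_add)
    moreover have "0 < u" using assms True by (simp add: u_def)
    ultimately have "gamma_density a u = w powr (a - 1) * exp ((a - 1) * ln (1 + r * v))
        * (exp (- w) * exp (- (w * r * v))) / Gamma a"
      by (simp add: gamma_density_def)
    also have "\<dots> = w powr (a - 1) * exp (- w) / Gamma a
        * (exp ((a - 1) * ln (1 + r * v)) * exp (- (w * r * v)))"
      by simp
    also have "exp ((a - 1) * ln (1 + r * v)) * exp (- (w * r * v)) = gamma_kernel (a - 1) w r v"
      using True by (simp add: gamma_kernel_def flip: exp_add)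
    finally show ?thesis unfolding eq .
  next
    case False
    then show ?thesis
      using assms unfolding eq gamma_density_def gamma_kernel_def u_def
      by (simp add: zero_less_mult_iff)
  qed
qed

lemma integral_gamma_density:
  assumes "0 < a"
  shows "(LBINT u. gamma_density a u) = 1"
proof -
  have "(\<integral>\<^sup>+u. ennreal (gamma_density a u) \<partial>lborel)
      = (\<integral>\<^sup>+u. ennreal (1 / Gamma a) * ennreal (indicator {0..} u * u powr (a - 1) / exp u) \<partial>lborel)"
    using Gamma_real_pos [OF assms]
    by (intro nn_integral_cong)
       (auto simp: gamma_density_def exp_minus field_simps indicator_def simp flip: ennreal_mult')
  also have "\<dots> = ennreal (1 / Gamma a) * ennreal (Gamma a)"
    by (simp add: nn_integral_cmult Gamma_conv_nn_integral_real [OF assms])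
  also have "\<dots> = 1"
    using Gamma_real_pos [OF assms] by (simp flip: ennreal_mult')
  finally show ?thesis
    using gamma_density_nonneg [OF assms] by (subst integral_eq_nn_integral) auto
qed

subsection \<open>Stirling's formula for the real Gamma function\<close>

text \<open>Up to a constant factor, this is the majorant in both dominated convergence arguments.
  It is bounded by twice the sum of the exponential density of rate 1/2 and its reflection, with
  equality except at 0, where both densities count.\<close>

lemma integrable_exp_minus_abs_half: "integrable lborel (\<lambda>v::real. exp (- \<bar>v\<bar> / 2))"
proof -
  have int: "integrable lborel (erlang_density 0 (1 / 2))"
    using nn_integral_erlang_ith_moment [of "1/2" 0 0]
    by (intro integrableI_nn_integral_finite [where x = 1]) auto
  then have "integrable lborel (\<lambda>v. 2 * (erlang_density 0 (1 / 2) v + erlang_density 0 (1 / 2) (- v)))"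
    using lborel_integrable_real_affine [OF int, of "-1" 0] by simp
  then show ?thesis
    by (rule Bochner_Integration.integrable_bound) (auto simp: erlang_density_def)
qed

text \<open>The difference of the two sides vanishes at 0 and has derivative
  \<open>x^2 / (1 + x)\<close>. This gives Gaussian decay to the left of the mode.\<close>

lemma ln_one_plus_le_nonpos:
  fixes s :: real
  assumes "-1 < s" "s \<le> 0"
  shows "ln (1 + s) - s \<le> - s\<^sup>2 / 2"
proof -
  have "ln (1 + s) - s + s\<^sup>2 / 2 \<le> ln (1 + 0) - 0 + 0\<^sup>2 / 2"
  proof (rule DERIV_nonneg_imp_nondecreasing [OF assms(2)])
    fix x assume "s \<le> x" "x \<le> 0"
    then have "0 < 1 + x" using assms by simp
    then have "((\<lambda>s. ln (1 + s) - s + s\<^sup>2 / 2) has_real_derivative x\<^sup>2 / (1 + x)) (at x)"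
      by (auto intro!: derivative_eq_intros simp: field_simps power2_eq_square)
    then show "\<exists>y. ((\<lambda>s. ln (1 + s) - s + s\<^sup>2 / 2) has_real_derivative y) (at x) \<and> 0 \<le> y"
      using \<open>0 < 1 + x\<close> by (intro exI conjI) auto
  qed
  then show ?thesis by simp
qed

text \<open>To the right of 0 the decay of \<open>ln (1 + s) - s\<close> is only linear for large
  \<open>s\<close>, hence the denominator \<open>1 + s\<close>. The difference of the two sides
  vanishes at 0 and has derivative \<open>- x^2 / (2 * (1 + x)^2)\<close>.\<close>

lemma ln_one_plus_le_nonneg:
  fixes s :: real
  assumes "0 \<le> s"
  shows "ln (1 + s) - s \<le> - s\<^sup>2 / (2 * (1 + s))"
proof -
  have "ln (1 + s) - s + s\<^sup>2 / (2 * (1 + s)) \<le> ln (1 + 0) - 0 + 0\<^sup>2 / (2 * (1 + 0))"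
  proof (rule DERIV_nonpos_imp_nonincreasing [OF assms])
    fix x :: real assume "0 \<le> x" "x \<le> s"
    have "((\<lambda>s. ln (1 + s) - s + s\<^sup>2 / (2 * (1 + s))) has_real_derivative
        1 / (1 + x) - 1 + (2 * x * (2 * (1 + x)) - x\<^sup>2 * 2) / (2 * (1 + x))\<^sup>2) (at x)"
      using \<open>0 \<le> x\<close> by (auto intro!: derivative_eq_intros simp: power2_eq_square)
    also have "1 / (1 + x) - 1 + (2 * x * (2 * (1 + x)) - x\<^sup>2 * 2) / (2 * (1 + x))\<^sup>2
        = - x\<^sup>2 / (2 * (1 + x)\<^sup>2)"
      using \<open>0 \<le> x\<close> by (simp add: divide_simps) (simp add: algebra_simps power2_eq_square)
    finally have "((\<lambda>s. ln (1 + s) - s + s\<^sup>2 / (2 * (1 + s))) has_real_derivative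
        - x\<^sup>2 / (2 * (1 + x)\<^sup>2)) (at x)" .
    then show "\<exists>y. ((\<lambda>s. ln (1 + s) - s + s\<^sup>2 / (2 * (1 + s))) has_real_derivative y) (at x) \<and> y \<le> 0"
      by (intro exI conjI) auto
  qed
  then show ?thesis by simp
qed

text \<open>With \<open>s = t / sqrt a\<close> the exponent is \<open>a * (ln (1 + s) - s)\<close>,
  and \<open>a * s^2 = t^2\<close>, so the two preceding bounds apply on either side of 0.\<close>

lemma gamma_kernel_central_bound:
  assumes "1 \<le> a"
  shows "gamma_kernel a a (1 / sqrt a) t \<le> exp (1 / 2) * exp (- \<bar>t\<bar> / 2)"
proof (cases "0 < 1 + 1 / sqrt a * t")
  case True
  define s where "s = t / sqrt a"
  have sa: "1 \<le> sqrt a" "sqrt a * sqrt a = a" using assms by auto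
  have t: "t = s * sqrt a" "a * s\<^sup>2 = t\<^sup>2" using sa(1) assms by (auto simp: s_def field_simps)
  have "a * (ln (1 + s) - s) \<le> 1 / 2 - \<bar>t\<bar> / 2"
  proof (cases "0 \<le> s")
    case True
    then have t0: "0 \<le> t" using t sa by simp
    have st: "s \<le> t" using t sa True mult_left_mono [of 1 "sqrt a" s] by simp
    have "a * (ln (1 + s) - s) \<le> a * (- s\<^sup>2 / (2 * (1 + s)))"
      using ln_one_plus_le_nonneg [OF True] assms by (intro mult_left_mono) auto
    also have "\<dots> = - (t\<^sup>2 / (2 * (1 + s)))"
      using t by simp
    \<comment> \<open>Replacing \<open>s\<close> by the larger \<open>t\<close> makes the bound
      uniform in \<open>a\<close>; here \<open>sqrt a\<close> is at least 1.\<close>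
    also have "\<dots> \<le> - (t\<^sup>2 / (2 * (1 + t)))"
      using st True by (intro le_imp_neg_le divide_left_mono) auto
    \<comment> \<open>This amounts to \<open>(t - 1) * (t + 1) <= t^2\<close>.\<close>
    also have "\<dots> \<le> 1 / 2 - \<bar>t\<bar> / 2"
      using t0 by (simp add: field_simps power2_eq_square)
    finally show ?thesis .
  next
    case s0: False
    have "a * (ln (1 + s) - s) \<le> a * (- s\<^sup>2 / 2)"
      using ln_one_plus_le_nonpos [of s] True s0 assms
      by (intro mult_left_mono) (auto simp: s_def)
    also have "\<dots> = - t\<^sup>2 / 2" using t by simp
    also have "\<dots> \<le> 1 / 2 - \<bar>t\<bar> / 2"
    proof -
      have "0 \<le> (\<bar>t\<bar> - 1)\<^sup>2" by simp
      then show ?thesis unfolding power2_diff by simp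
    qed
    finally show ?thesis .
  qed
  moreover have "1 / sqrt a * t = s" "a * (1 / sqrt a) * t = a * s" by (simp_all add: s_def)
  ultimately show ?thesis
    using True by (simp add: gamma_kernel_def algebra_simps flip: exp_add)
qed (simp add: gamma_kernel_def)

text \<open>The linear term of the logarithm cancels against \<open>a * (1 / sqrt a) * t\<close>,
  leaving the quadratic term \<open>- t^2 / 2\<close>.\<close>

lemma gamma_kernel_central_tendsto:
  "((\<lambda>a. gamma_kernel a a (1 / sqrt a) t) \<longlongrightarrow> exp (- t\<^sup>2 / 2)) at_top"
proof -
  have "\<forall>\<^sub>F a in at_top. 0 < 1 + 1 / sqrt a * t"
    by real_asymp
  then have ev: "\<forall>\<^sub>F a in at_top. exp (a * ln (1 + 1 / sqrt a * t) - a * (1 / sqrt a) * t)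
      = gamma_kernel a a (1 / sqrt a) t"
    by eventually_elim (simp add: gamma_kernel_def)
  have "((\<lambda>a. a * ln (1 + 1 / sqrt a * t) - a * (1 / sqrt a) * t) \<longlongrightarrow> - t\<^sup>2 / 2) at_top"
    by (cases t "0::real" rule: linorder_cases) (real_asymp simp: power2_eq_square)+
  then have "((\<lambda>a. exp (a * ln (1 + 1 / sqrt a * t) - a * (1 / sqrt a) * t)) \<longlongrightarrow> exp (- t\<^sup>2 / 2)) at_top"
    by (rule tendsto_exp)
  then show ?thesis by (rule Lim_transform_eventually [OF _ ev])
qed

lemma Gamma_Stirling_real:
  "((\<lambda>a::real. Gamma a * sqrt a * exp a / a powr a) \<longlongrightarrow> sqrt (2 * pi)) at_top"
proof -
  have "((\<lambda>a. LBINT t. gamma_kernel a a (1 / sqrt a) t) \<longlongrightarrow> (LBINT t. exp (- t\<^sup>2 / 2))) at_top"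
  proof (rule integral_dominated_convergence_at_top [where w = "\<lambda>t. exp (1 / 2) * exp (- \<bar>t\<bar> / 2)"])
    show "\<forall>\<^sub>F a in at_top. AE t in lborel. norm (gamma_kernel a a (1 / sqrt a) t)
        \<le> exp (1 / 2) * exp (- \<bar>t\<bar> / 2)"
      using eventually_ge_at_top [of 1]
      by eventually_elim (simp only: real_norm_def abs_of_nonneg gamma_kernel_nonneg
            gamma_kernel_central_bound AE_I2)
  qed (use integrable_exp_minus_abs_half gamma_kernel_central_tendsto in \<open>auto\<close>)
  moreover have "(LBINT t::real. exp (- t\<^sup>2 / 2)) = sqrt (2 * pi)"
    using integral_std_normal_moment_even [of 0] by (simp add: std_normal_density_def field_simps)
  ultimately have lim: "((\<lambda>a. LBINT t. gamma_kernel a a (1 / sqrt a) t) \<longlongrightarrow> sqrt (2 * pi)) at_top"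
    by simp
  have "\<forall>\<^sub>F a in at_top. (LBINT t. gamma_kernel a a (1 / sqrt a) t)
      = Gamma a * sqrt a * exp a / a powr a"
    using eventually_gt_at_top [of 0]
  proof eventually_elim
    case (elim a)
    have Gamma_nonzero: "Gamma a \<noteq> 0"
      using Gamma_real_pos [OF elim] by (simp only: less_imp_neq not_sym)
    \<comment> \<open>Shape \<open>a + 1\<close> puts the mode of the density at \<open>a\<close>,
      so that the exponent and the base point of the kernel are both \<open>a\<close>. The
      recurrence for Gamma later returns to \<open>Gamma a\<close>.\<close>
    have "1 = (LBINT u. gamma_density (a + 1) u)"
      using integral_gamma_density [of "a + 1"] elim by simp
    also have "\<dots> = sqrt a * (LBINT t. gamma_density (a + 1) (a + a * (1 / sqrt a) * t))"
      using elim by (subst lborel_integral_real_affine [where c = "sqrt a" and t = a])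
        (auto simp: real_div_sqrt)
    also have "\<dots> = sqrt a * (a powr a * exp (- a) / Gamma (a + 1)) * (LBINT t. gamma_kernel a a (1 / sqrt a) t)"
      using elim by (subst gamma_density_affine) simp_all
    also have "\<dots> = a powr a / (sqrt a * exp a * Gamma a) * (LBINT t. gamma_kernel a a (1 / sqrt a) t)"
    proof -
      have "a \<notin> \<int>\<^sub>\<le>\<^sub>0" using elim by (auto elim!: nonpos_Ints_cases)
      then have "sqrt a * (a powr a * exp (- a) / Gamma (a + 1))
          = (sqrt a / a) * (a powr a * exp (- a) / Gamma a)"
        by (simp add: Gamma_plus1)
      also have "\<dots> = a powr a / (sqrt a * exp a * Gamma a)"
        using elim by (subst sqrt_divide_self_eq) (simp_all add: exp_minus divide_inverse)
      finally show ?thesis by simp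
    qed
    finally have "1 = a powr a / (sqrt a * exp a * Gamma a) * (LBINT t. gamma_kernel a a (1 / sqrt a) t)" .
    moreover have "a powr a \<noteq> 0" "sqrt a * exp a * Gamma a \<noteq> 0"
      using elim Gamma_nonzero by simp_all
    moreover have "I = B / A" if "1 = A / B * I" "A \<noteq> 0" "B \<noteq> 0" for A B I :: real
      using that by (simp add: field_simps)
    ultimately have "(LBINT t. gamma_kernel a a (1 / sqrt a) t) = sqrt a * exp a * Gamma a / a powr a"
      by blast
    then show ?case by (simp only: mult_ac)
  qed
  then show ?thesis by (rule Lim_transform_eventually [OF lim])
qed

subsection \<open>The upper tail of the Gamma distribution\<close>

text \<open>The error of replacing \<open>n * ln (1 - p n)\<close> by \<open>- n * p n\<close> is at
  most \<open>2 * n * (p n)^2\<close>, which is a convergent sequence times one that tends to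
  0.\<close>

lemma tendsto_one_minus_power:
  fixes p :: "nat \<Rightarrow> real"
  assumes "(\<lambda>n. real n * p n) \<longlonglongrightarrow> c"
  shows "(\<lambda>n. (1 - p n) ^ n) \<longlonglongrightarrow> exp (- c)"
proof -
  have "(\<lambda>n. (real n * p n) * (1 / real n)) \<longlonglongrightarrow> c * 0"
    by (intro tendsto_mult assms lim_1_over_n)
  moreover have "\<forall>\<^sub>F n in sequentially. (real n * p n) * (1 / real n) = p n"
    using eventually_gt_at_top [of 0] by eventually_elim simp
  ultimately have p0: "p \<longlonglongrightarrow> 0"
    using Lim_transform_eventually by fastforce
  have "(\<lambda>n. \<bar>p n\<bar>) \<longlonglongrightarrow> 0" using p0 by (rule tendsto_rabs_zero)
  then have small: "\<forall>\<^sub>F n in sequentially. \<bar>p n\<bar> < 1 / 2"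
    by (rule order_tendstoD) simp
  have "(\<lambda>n. real n * ln (1 - p n) + real n * p n) \<longlonglongrightarrow> 0"
  proof (rule Lim_null_comparison)
    show "\<forall>\<^sub>F n in sequentially. norm (real n * ln (1 - p n) + real n * p n) \<le> 2 * \<bar>real n * p n\<bar> * \<bar>p n\<bar>"
      using small
    proof eventually_elim
      case (elim n)
      have "\<bar>ln (1 - p n) + p n\<bar> \<le> 2 * \<bar>p n\<bar> * \<bar>p n\<bar>"
        using abs_ln_one_plus_x_minus_x_bound [of "- p n"] elim by (simp add: power2_eq_square)
      then have "real n * \<bar>ln (1 - p n) + p n\<bar> \<le> real n * (2 * \<bar>p n\<bar> * \<bar>p n\<bar>)"
        by (intro mult_left_mono) auto
      then show ?case
        by (simp add: abs_mult mult.assoc mult.left_commute flip: distrib_left)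
    qed
    have "(\<lambda>n. 2 * \<bar>real n * p n\<bar> * \<bar>p n\<bar>) \<longlonglongrightarrow> 2 * \<bar>c\<bar> * \<bar>0\<bar>"
      by (intro tendsto_intros assms p0)
    then show "(\<lambda>n. 2 * \<bar>real n * p n\<bar> * \<bar>p n\<bar>) \<longlonglongrightarrow> 0" by simp
  qed
  from tendsto_diff [OF this assms] have "(\<lambda>n. real n * ln (1 - p n)) \<longlonglongrightarrow> - c" by simp
  then have "(\<lambda>n. exp (real n * ln (1 - p n))) \<longlonglongrightarrow> exp (- c)" by (rule tendsto_exp)
  moreover have "\<forall>\<^sub>F n in sequentially. exp (real n * ln (1 - p n)) = (1 - p n) ^ n"
    using small by eventually_elim (simp add: exp_of_nat_mult)
  ultimately show ?thesis by (rule Lim_transform_eventually)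
qed


lemma integral_exp_minus_tail:
  "(LBINT v. indicator {x<..} v * exp (- v)) = exp (- x :: real)"
proof -
  have "(\<integral>\<^sup>+v. ennreal (exp (- v)) * indicator {x..} v \<partial>lborel) = ennreal (0 - - exp (- x))"
  proof (rule nn_integral_FTC_atLeast)
    show "((\<lambda>v::real. - exp (- v)) \<longlongrightarrow> 0) at_top" by real_asymp
  qed (auto intro!: derivative_eq_intros)
  also have "(\<integral>\<^sup>+v. ennreal (exp (- v)) * indicator {x..} v \<partial>lborel)
      = (\<integral>\<^sup>+v. ennreal (indicator {x..} v * exp (- v)) \<partial>lborel)"
    by (intro nn_integral_cong) (simp add: indicator_def)
  finally have "(LBINT v. indicator {x..} v * exp (- v)) = exp (- x)"
    by (subst integral_eq_nn_integral) auto
  moreover have "(LBINT v. indicator {x<..} v * exp (- v)) = (LBINT v. indicator {x..} v * exp (- v))"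
    by (intro integral_cong_AE)
       (use AE_lborel_singleton [of x] in \<open>auto simp: indicator_def elim: eventually_mono\<close>)
  ultimately show ?thesis by simp
qed

text \<open>Replacing the logarithm by its tangent at 1 leaves a pure exponential in
  \<open>v\<close>, whose rate is the quantity assumed to tend to -1 in the next lemma.\<close>

lemma gamma_kernel_le_exp:
  assumes "0 \<le> c"
  shows "gamma_kernel c w r v \<le> exp ((c * r - w * r) * v)"
proof (cases "0 < 1 + r * v")
  case True
  then have "ln (1 + r * v) \<le> r * v" using ln_le_minus_one [OF True] by simp
  then have "c * ln (1 + r * v) \<le> c * (r * v)" using assms by (rule mult_left_mono)
  then show ?thesis using True by (simp add: gamma_kernel_def algebra_simps)
qed (simp add: gamma_kernel_def)

text \<open>The exponent is \<open>(c * r - w * r) * v + c * (ln (1 + r * v) - r * v)\<close>: the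
  first term tends to \<open>- v\<close>, and the second is of order \<open>c * r^2 * v^2\<close>.
  Dominated convergence then gives the limit of the integrals.\<close>

lemma gamma_kernel_tail_tendsto:
  fixes c w r :: "nat \<Rightarrow> real"
  assumes c: "\<forall>\<^sub>F n in sequentially. 0 \<le> c n"
    and r: "r \<longlonglongrightarrow> 0"
    and cr2: "(\<lambda>n. c n * (r n)\<^sup>2) \<longlonglongrightarrow> 0"
    and slope: "(\<lambda>n. c n * r n - w n * r n) \<longlonglongrightarrow> -1"
  shows "(\<lambda>n. LBINT v. indicator {x<..} v * gamma_kernel (c n) (w n) (r n) v) \<longlonglongrightarrow> exp (- x)"
proof -
  have lim: "(\<lambda>n. gamma_kernel (c n) (w n) (r n) v) \<longlonglongrightarrow> exp (- v)" for v
  proof -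
    have rv: "(\<lambda>n. \<bar>r n * v\<bar>) \<longlonglongrightarrow> 0"
      by (rule tendsto_rabs_zero, rule tendsto_mult_left_zero, rule r)
    then have small: "\<forall>\<^sub>F n in sequentially. \<bar>r n * v\<bar> < 1 / 2"
      by (rule order_tendstoD) simp
    have "(\<lambda>n. c n * (ln (1 + r n * v) - r n * v)) \<longlonglongrightarrow> 0"
    proof (rule Lim_null_comparison)
      show "\<forall>\<^sub>F n in sequentially. norm (c n * (ln (1 + r n * v) - r n * v)) \<le> 2 * v\<^sup>2 * (c n * (r n)\<^sup>2)"
        using small c
      proof eventually_elim
        case (elim n)
        have "\<bar>ln (1 + r n * v) - r n * v\<bar> \<le> 2 * (r n * v)\<^sup>2"
          using elim by (intro abs_ln_one_plus_x_minus_x_bound) simp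
        then have "c n * \<bar>ln (1 + r n * v) - r n * v\<bar> \<le> c n * (2 * (r n * v)\<^sup>2)"
          using elim by (intro mult_left_mono) auto
        then show ?case using elim by (simp add: abs_mult power_mult_distrib mult_ac)
      qed
      show "(\<lambda>n. 2 * v\<^sup>2 * (c n * (r n)\<^sup>2)) \<longlonglongrightarrow> 0"
        by (rule tendsto_mult_right_zero, rule cr2)
    qed
    moreover have "(\<lambda>n. (c n * r n - w n * r n) * v) \<longlonglongrightarrow> -1 * v"
      by (intro tendsto_mult slope tendsto_const)
    ultimately have "(\<lambda>n. (c n * r n - w n * r n) * v + c n * (ln (1 + r n * v) - r n * v)) \<longlonglongrightarrow> -1 * v + 0"
      by (intro tendsto_add)
    then have "(\<lambda>n. exp ((c n * r n - w n * r n) * v + c n * (ln (1 + r n * v) - r n * v)))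
        \<longlonglongrightarrow> exp (- v)"
      using tendsto_exp by fastforce
    moreover have "\<forall>\<^sub>F n in sequentially.
        exp ((c n * r n - w n * r n) * v + c n * (ln (1 + r n * v) - r n * v))
        = gamma_kernel (c n) (w n) (r n) v"
      using small by eventually_elim (auto simp: gamma_kernel_def algebra_simps)
    ultimately show ?thesis by (rule Lim_transform_eventually)
  qed
  \<comment> \<open>The upper bound -1/2 on the rate yields decay for \<open>v >= 0\<close>; the
    lower bound -2 controls the stretch \<open>x < v < 0\<close> that occurs for negative
    \<open>x\<close>.\<close>
  have "\<forall>\<^sub>F n in sequentially. 0 \<le> c n \<and> -2 < c n * r n - w n * r n \<and> c n * r n - w n * r n < -1 / 2"
    using c order_tendstoD(1) [OF slope, of "-2"] order_tendstoD(2) [OF slope, of "-1/2"]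
    by (simp add: eventually_conj_iff)
  then obtain N where N: "\<And>n. N \<le> n \<Longrightarrow>
      0 \<le> c n \<and> -2 < c n * r n - w n * r n \<and> c n * r n - w n * r n < -1 / 2"
    by (auto simp: eventually_sequentially)
  \<comment> \<open>For \<open>x < v < 0\<close> the exponent is at most \<open>2 * |v|\<close>, and
    \<open>2 * |v| + |v| / 2 <= 3 * |x|\<close>; this is the origin of the factor 3.\<close>
  have bound: "indicator {x<..} v * gamma_kernel (c n) (w n) (r n) v
      \<le> exp (3 * \<bar>x\<bar>) * exp (- \<bar>v\<bar> / 2)" if "N \<le> n" for n v
  proof (cases "x < v")
    case True
    define m where "m = c n * r n - w n * r n"
    have m: "-2 < m" "m < -1/2" using N [OF that] by (auto simp: m_def)
    have "m * v \<le> 3 * \<bar>x\<bar> - \<bar>v\<bar> / 2"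
    proof (cases "0 \<le> v")
      case True
      then have "m * v \<le> (-1/2) * v" using m by (intro mult_right_mono) auto
      then show ?thesis using True by simp
    next
      case False
      then have "m * v \<le> -2 * v" using m by (intro mult_right_mono_neg) auto
      then show ?thesis using False \<open>x < v\<close> by simp
    qed
    moreover have "gamma_kernel (c n) (w n) (r n) v \<le> exp (m * v)"
      unfolding m_def using N [OF that] by (intro gamma_kernel_le_exp) simp
    ultimately show ?thesis using True by (simp flip: exp_add add: order_trans)
  qed simp
  \<comment> \<open>The majorant holds only from \<open>N\<close> on, so the sequence is shifted by
    \<open>N\<close>.\<close>
  have "(\<lambda>n. LBINT v. indicator {x<..} v * gamma_kernel (c (n + N)) (w (n + N)) (r (n + N)) v)
      \<longlonglongrightarrow> (LBINT v. indicator {x<..} v * exp (- v))"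
  proof (rule integral_dominated_convergence [where w = "\<lambda>v. exp (3 * \<bar>x\<bar>) * exp (- \<bar>v\<bar> / 2)"])
    show "integrable lborel (\<lambda>v. exp (3 * \<bar>x\<bar>) * exp (- \<bar>v\<bar> / 2))"
      using integrable_exp_minus_abs_half by simp
    show "AE v in lborel. (\<lambda>n. indicator {x<..} v * gamma_kernel (c (n + N)) (w (n + N)) (r (n + N)) v)
        \<longlonglongrightarrow> indicator {x<..} v * exp (- v)"
      by (intro AE_I2 tendsto_mult tendsto_const LIMSEQ_ignore_initial_segment lim)
    show "AE v in lborel. norm (indicator {x<..} v * gamma_kernel (c (n + N)) (w (n + N)) (r (n + N)) v)
        \<le> exp (3 * \<bar>x\<bar>) * exp (- \<bar>v\<bar> / 2)" for n
      using bound [of "n + N"] by (intro AE_I2) (simp add: gamma_kernel_nonneg abs_mult)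
  qed auto
  then show ?thesis
    unfolding integral_exp_minus_tail by (rule LIMSEQ_offset)
qed

text \<open>The increasing substitution \<open>u = w + w * r * v\<close> has Jacobian
  \<open>w * r\<close> and carries the tail event to \<open>v > x\<close>.\<close>

lemma (in prob_space) gamma_tail_prob:
  assumes X: "distributed M lborel X (\<lambda>u. ennreal (gamma_density a u))"
    and "0 < a" "0 < w" "0 < r"
  shows "prob (X -` {..w + w * r * x} \<inter> space M)
    = 1 - w * r * (w powr (a - 1) * exp (- w) / Gamma a)
        * (LBINT v. indicator {x<..} v * gamma_kernel (a - 1) w r v)"
proof -
  define y where "y = w + w * r * x"
  have X_meas [measurable]: "X \<in> borel_measurable M"
    using distributed_measurable [OF X] by simp
  have ind: "indicator {y<..} (w + w * r * v) = (indicator {x<..} v :: real)" for v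
    using assms by (auto simp: y_def indicator_def)
  have "prob (X -` {y<..} \<inter> space M) = (\<integral>\<omega>. indicator {y<..} (X \<omega>) \<partial>M)"
  proof -
    have "(\<integral>\<omega>. indicator {y<..} (X \<omega>) \<partial>M)
        = (\<integral>\<omega>. indicator (X -` {y<..} \<inter> space M) \<omega> \<partial>M :: real)"
      by (intro Bochner_Integration.integral_cong) (auto simp: indicator_def)
    then show ?thesis by (simp add: Int_assoc)
  qed
  also have "\<dots> = (LBINT u. gamma_density a u * indicator {y<..} u)"
    using assms by (subst distributed_integral [OF X]) (auto simp: gamma_density_nonneg)
  also have "\<dots> = w * r * (LBINT v. gamma_density a (w + w * r * v) * indicator {y<..} (w + w * r * v))"
    using assms by (subst lborel_integral_real_affine [where c = "w * r" and t = w]) (auto simp: abs_mult)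
  also have "(LBINT v. gamma_density a (w + w * r * v) * indicator {y<..} (w + w * r * v))
      = (LBINT v. w powr (a - 1) * exp (- w) / Gamma a
          * (indicator {x<..} v * gamma_kernel (a - 1) w r v))"
    unfolding ind gamma_density_affine [OF \<open>0 < w\<close>] by (simp only: mult_ac)
  also have "\<dots> = w powr (a - 1) * exp (- w) / Gamma a
      * (LBINT v. indicator {x<..} v * gamma_kernel (a - 1) w r v)"
    by (rule integral_mult_right_zero)
  finally have "prob (X -` {y<..} \<inter> space M) = w * r * (w powr (a - 1) * exp (- w) / Gamma a)
        * (LBINT v. indicator {x<..} v * gamma_kernel (a - 1) w r v)"
    by (simp only: mult_ac)
  moreover have "prob (X -` {..y} \<inter> space M) = 1 - prob (X -` {y<..} \<inter> space M)"
    by (subst prob_compl [symmetric]) (auto intro!: arg_cong [where f = prob])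
  ultimately show ?thesis unfolding y_def by simp
qed

text \<open>This is the exponentiated centering equation, with
  \<open>a + b * sqrt a = a * (1 + t)\<close> for \<open>t = b / sqrt a\<close>. The factor
  \<open>sqrt (2 * pi)\<close> will cancel the one from Stirling's formula.\<close>

lemma centering_prefactor_eq:
  assumes "0 < a" "0 < b" "0 < n" and eq: "centering_equation a n b"
  shows "real n * ((a + b * sqrt a) powr a * exp (- (a + b * sqrt a)))
    = a powr a * exp (- a) * b * sqrt (2 * pi)"
proof -
  define t where "t = b / sqrt a"
  have t: "0 < 1 + t" "a + b * sqrt a = a * (1 + t)"
    using assms by (auto simp: t_def field_simps add_pos_pos)
  have "a * ln (1 + t) - b * sqrt a = ln b + ln (2 * pi) / 2 - ln (real n)"
    using eq by (simp add: centering_equation_def t_def)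
  also have "\<dots> = ln b + ln (sqrt (2 * pi)) - ln (real n)"
    by (simp add: ln_sqrt)
  finally have "exp (a * ln (1 + t) - b * sqrt a) = b * sqrt (2 * pi) / real n"
    using assms by (simp add: exp_diff exp_add)
  then have *: "real n * exp (a * ln (1 + t) - b * sqrt a) = b * sqrt (2 * pi)"
    using assms by (simp add: field_simps)
  have "(a + b * sqrt a) powr a * exp (- (a + b * sqrt a))
      = (a powr a * exp (a * ln (1 + t))) * (exp (- a) * exp (- (b * sqrt a)))"
  proof -
    have "(a + b * sqrt a) powr a = a powr a * exp (a * ln (1 + t))"
      using assms t by (simp add: powr_mult) (simp add: powr_def)
    moreover have "exp (- (a + b * sqrt a)) = exp (- a) * exp (- (b * sqrt a))"
      by (simp flip: exp_add)
    ultimately show ?thesis by (simp only:)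
  qed
  also have "\<dots> = a powr a * exp (- a) * exp (a * ln (1 + t) - b * sqrt a)"
    by (simp add: exp_diff exp_minus field_simps)
  finally show ?thesis using * by (simp add: mult_ac)
qed


subsection \<open>The centering equation\<close>

definition centering_lhs :: "real \<Rightarrow> real \<Rightarrow> real" where
  "centering_lhs a z = ln z + 1 / 2 * ln (2 * pi) + z * sqrt a - a * ln (1 + z / sqrt a)"

lemma centering_equation_iff: "centering_equation a n z \<longleftrightarrow> centering_lhs a z = ln (real n)"
  by (simp add: centering_equation_def centering_lhs_def)

text \<open>The last two terms contribute \<open>sqrt a - a / (sqrt a + z)\<close>, combined here
  into one fraction so that positivity is visible.\<close>

lemma DERIV_centering_lhs:
  assumes "0 < a" "0 < z"
  shows "(centering_lhs a has_real_derivative 1 / z + z * sqrt a / (sqrt a + z)) (at z)"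
proof -
  obtain q where q: "0 < q" "a = q * q" "sqrt a = q"
    using assms by (metis real_sqrt_gt_zero real_sqrt_mult_self abs_of_pos)
  have pos: "0 < 1 + z / q" using assms q by (simp add: add_pos_pos)
  have "(centering_lhs a has_real_derivative
      1 / z + q - (q * q) * ((1 / q) / (1 + z / q))) (at z)"
    unfolding centering_lhs_def [abs_def] q(3) unfolding q(2)
    using assms q pos by (auto intro!: derivative_eq_intros)
  also have "1 / z + q - (q * q) * ((1 / q) / (1 + z / q)) = 1 / z + z * q / (q + z)"
  proof -
    have "1 + z / q = (q + z) / q" using q by (simp add: field_simps)
    then have "(q * q) * ((1 / q) / (1 + z / q)) = q * q / (q + z)" using q by simp
    moreover have "q - q * q / (q + z) = z * q / (q + z)"
      using q assms by (simp add: field_simps)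
    ultimately show ?thesis by simp
  qed
  finally show ?thesis unfolding q(3) .
qed

lemma centering_lhs_strict_mono:
  assumes "0 < a" "0 < z" "z < z'"
  shows "centering_lhs a z < centering_lhs a z'"
proof (rule DERIV_pos_imp_increasing [OF \<open>z < z'\<close>])
  fix x assume "z \<le> x" "x \<le> z'"
  then have "0 < x" using assms by simp
  then have "0 < 1 / x + x * sqrt a / (sqrt a + x)"
    using assms by (simp add: add_pos_pos)
  then show "\<exists>y. (centering_lhs a has_real_derivative y) (at x) \<and> 0 < y"
    using DERIV_centering_lhs [OF \<open>0 < a\<close> \<open>0 < x\<close>] by blast
qed

section \<open>Solving the centering equation under the growth condition\<close>

context
  fixes \<alpha> :: "nat \<Rightarrow> real"
  assumes growth: "filterlim (\<lambda>n. \<alpha> n / ln (real n)) at_top sequentially"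
begin

lemma ln_real_at_top: "filterlim (\<lambda>n. ln (real n)) at_top sequentially"
  by (rule filterlim_compose [OF ln_at_top filterlim_real_sequentially])

text \<open>The bound 1 on the shape, rather than 0, keeps the exponent
  \<open>\<alpha> n - 1\<close> of the tail kernel nonnegative.\<close>

lemma eventually_shape_pos: "\<forall>\<^sub>F n in sequentially. 1 < ln (real n) \<and> 1 < \<alpha> n"
proof -
  have "\<forall>\<^sub>F n in sequentially. 1 < ln (real n)"
    using ln_real_at_top by (simp add: filterlim_at_top_dense)
  moreover have "\<forall>\<^sub>F n in sequentially. 1 < \<alpha> n / ln (real n)"
    using growth by (simp add: filterlim_at_top_dense)
  ultimately show ?thesis
    by eventually_elim (auto simp: field_simps)
qed

lemma shape_at_top: "filterlim \<alpha> at_top sequentially"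
proof -
  have "filterlim (\<lambda>n. \<alpha> n / ln (real n) * ln (real n)) at_top sequentially"
    by (intro filterlim_at_top_mult_at_top growth ln_real_at_top)
  moreover have "\<forall>\<^sub>F n in sequentially. \<alpha> n / ln (real n) * ln (real n) = \<alpha> n"
    using eventually_shape_pos by eventually_elim simp
  ultimately show ?thesis using filterlim_cong by force
qed

lemma sqrt_log_over_shape: "(\<lambda>n. sqrt (2 * ln (real n)) / sqrt (\<alpha> n)) \<longlonglongrightarrow> 0"
proof -
  have "(\<lambda>n. inverse (\<alpha> n / ln (real n))) \<longlonglongrightarrow> 0"
    using growth by (rule tendsto_inverse_0_at_top)
  then have "(\<lambda>n. sqrt (2 * inverse (\<alpha> n / ln (real n)))) \<longlonglongrightarrow> sqrt (2 * 0)"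
    by (intro tendsto_intros)
  then show ?thesis by (simp add: real_sqrt_divide [symmetric])
qed

text \<open>With \<open>t = z / sqrt a\<close>, which tends to 0 by the growth condition, the last
  two terms are \<open>a * (t - ln (1 + t))\<close>, asymptotic to
  \<open>a * t^2 / 2 = c^2 * log n\<close>. The logarithmic terms are of smaller order.\<close>

lemma centering_lhs_over_log:
  assumes "0 < c"
  shows "(\<lambda>n. centering_lhs (\<alpha> n) (c * sqrt (2 * ln (real n))) / ln (real n)) \<longlonglongrightarrow> c\<^sup>2"
proof -
  define t where "t n = c * sqrt (2 * ln (real n)) / sqrt (\<alpha> n)" for n
  have "(\<lambda>n. c * (sqrt (2 * ln (real n)) / sqrt (\<alpha> n))) \<longlonglongrightarrow> c * 0"
    by (intro tendsto_mult tendsto_const sqrt_log_over_shape)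
  then have "t \<longlonglongrightarrow> 0" by (simp add: t_def [abs_def])
  moreover have "\<forall>\<^sub>F n in sequentially. 0 < t n"
    using eventually_shape_pos by eventually_elim (use assms in \<open>simp add: t_def\<close>)
  ultimately have t: "filterlim t (at_right 0) sequentially"
    by (simp add: filterlim_at eventually_conj_iff eventually_mono)
  have "((\<lambda>t::real. (t - ln (1 + t)) / t\<^sup>2) \<longlongrightarrow> 1 / 2) (at_right 0)"
    by real_asymp
  from filterlim_compose [OF this t]
  have quad: "(\<lambda>n. (t n - ln (1 + t n)) / (t n)\<^sup>2) \<longlonglongrightarrow> 1 / 2" .
  have "((\<lambda>L::real. (ln (c * sqrt (2 * L)) + 1 / 2 * ln (2 * pi)) / L) \<longlongrightarrow> 0) at_top"
    using assms by real_asymp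
  from filterlim_compose [OF this ln_real_at_top]
  have "(\<lambda>n. (ln (c * sqrt (2 * ln (real n))) + 1 / 2 * ln (2 * pi)) / ln (real n)
      + 2 * c\<^sup>2 * ((t n - ln (1 + t n)) / (t n)\<^sup>2)) \<longlonglongrightarrow> 0 + 2 * c\<^sup>2 * (1 / 2)"
    by (intro tendsto_add tendsto_mult tendsto_const quad)
  moreover have "\<forall>\<^sub>F n in sequentially.
      (ln (c * sqrt (2 * ln (real n))) + 1 / 2 * ln (2 * pi)) / ln (real n)
      + 2 * c\<^sup>2 * ((t n - ln (1 + t n)) / (t n)\<^sup>2)
      = centering_lhs (\<alpha> n) (c * sqrt (2 * ln (real n))) / ln (real n)"
    using eventually_shape_pos \<open>\<forall>\<^sub>F n in sequentially. 0 < t n\<close>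
  proof eventually_elim
    case (elim n)
    define a L where "a = \<alpha> n" and "L = ln (real n)"
    define z where "z = c * sqrt (2 * L)"
    have pos: "0 < L" "0 < a" "sqrt a * sqrt a = a" using elim by (auto simp: L_def a_def)
    have tz: "t n = z / sqrt a" by (simp add: t_def z_def a_def L_def)
    have z2: "z\<^sup>2 = 2 * c\<^sup>2 * L"
      using pos by (simp add: z_def power_mult_distrib)
    have "a * (t n)\<^sup>2 = z\<^sup>2" using pos by (simp add: tz power_divide)
    \<comment> \<open>This identifies the weight of the quadratic quotient: \<open>2 * c^2\<close>
      is \<open>a * t^2 / L\<close>.\<close>
    then have "2 * c\<^sup>2 / (t n)\<^sup>2 = a / L"
      using elim pos unfolding z2 by (simp add: divide_simps)
    moreover have "a * t n = z * sqrt a"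
      using pos by (simp add: tz field_simps)
    moreover have "2 * c\<^sup>2 * ((t n - ln (1 + t n)) / (t n)\<^sup>2) = 2 * c\<^sup>2 / (t n)\<^sup>2 * (t n - ln (1 + t n))"
      by simp
    ultimately have "2 * c\<^sup>2 * ((t n - ln (1 + t n)) / (t n)\<^sup>2) = (z * sqrt a - a * ln (1 + t n)) / L"
      by (simp add: right_diff_distrib diff_divide_distrib)
    then show ?case
      unfolding centering_lhs_def a_def [symmetric] L_def [symmetric] z_def [symmetric] tz [symmetric]
      by (simp add: add_divide_distrib diff_divide_distrib)
  qed
  ultimately have "(\<lambda>n. centering_lhs (\<alpha> n) (c * sqrt (2 * ln (real n))) / ln (real n))
      \<longlonglongrightarrow> 0 + 2 * c\<^sup>2 * (1 / 2)"
    by (rule Lim_transform_eventually)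
  then show ?thesis by simp
qed

text \<open>Together with its counterpart for \<open>c > 1\<close>, this brackets positive solutions
  between multiples of \<open>sqrt (2 * log n)\<close> arbitrarily close to 1.\<close>

lemma centering_lhs_less_log:
  assumes "0 < c" "c < 1"
  shows "\<forall>\<^sub>F n in sequentially. centering_lhs (\<alpha> n) (c * sqrt (2 * ln (real n))) < ln (real n)"
proof -
  have "c\<^sup>2 < 1" using assms by (simp add: power_less_one_iff)
  from order_tendstoD(2) [OF centering_lhs_over_log [OF assms(1)] this] eventually_shape_pos
  show ?thesis by eventually_elim (simp add: field_simps)
qed

lemma centering_lhs_greater_log:
  assumes "1 < c"
  shows "\<forall>\<^sub>F n in sequentially. ln (real n) < centering_lhs (\<alpha> n) (c * sqrt (2 * ln (real n)))"
proof -
  have "1 < c\<^sup>2" "0 < c" using assms by (simp_all add: one_less_power)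
  from order_tendstoD(1) [OF centering_lhs_over_log [OF this(2)] this(1)] eventually_shape_pos
  show ?thesis by eventually_elim (simp add: field_simps)
qed

text \<open>The intermediate value theorem gives a positive solution for each large
  \<open>n\<close>; monotonicity then squeezes its ratio to \<open>sqrt (2 * log n)\<close> towards
  1.\<close>

lemma centering_seq_exists: "\<exists>b. centering_seq \<alpha> b"
proof -
  have "\<forall>\<^sub>F n in sequentially. \<exists>z>0. centering_lhs (\<alpha> n) z = ln (real n)"
    using eventually_shape_pos centering_lhs_less_log [of "1/2", simplified]
      centering_lhs_greater_log [of 2, simplified]
  proof eventually_elim
    case (elim n)
    define R where "R = sqrt (2 * ln (real n))"
    have R: "0 < R" using elim by (simp add: R_def)
    have "\<exists>z. R / 2 \<le> z \<and> z \<le> 2 * R \<and> centering_lhs (\<alpha> n) z = ln (real n)"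
    proof (rule IVT')
      show "continuous_on {R / 2..2 * R} (centering_lhs (\<alpha> n))"
        using elim R
        by (auto intro!: continuous_at_imp_continuous_on DERIV_isCont [OF DERIV_centering_lhs])
    qed (use elim R in \<open>auto simp: R_def\<close>)
    then obtain z where "R / 2 \<le> z" "centering_lhs (\<alpha> n) z = ln (real n)" by blast
    moreover have "0 < R / 2" using R by simp
    ultimately show ?case using less_le_trans by blast
  qed
  then obtain b where b: "\<forall>\<^sub>F n in sequentially. 0 < b n \<and> centering_lhs (\<alpha> n) (b n) = ln (real n)"
    unfolding eventually_ex by blast
  have "(\<lambda>n. b n / sqrt (2 * ln (real n))) \<longlonglongrightarrow> 1"
  proof (rule order_tendstoI)
    fix l :: real assume "l < 1"
    \<comment> \<open>The comparison point must be positive, whereas \<open>l\<close> need not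
      be.\<close>
    define c where "c = max l (1 / 2)"
    have c: "0 < c" "c < 1" "l \<le> c" using \<open>l < 1\<close> by (auto simp: c_def)
    show "\<forall>\<^sub>F n in sequentially. l < b n / sqrt (2 * ln (real n))"
      using centering_lhs_less_log [OF c(1,2)] b eventually_shape_pos
    proof eventually_elim
      case (elim n)
      \<comment> \<open>Otherwise monotonicity would force the left-hand side at \<open>b n\<close>
        below \<open>log n\<close>.\<close>
      have "\<not> b n \<le> c * sqrt (2 * ln (real n))"
        using centering_lhs_strict_mono [of "\<alpha> n" "b n" "c * sqrt (2 * ln (real n))"] elim
        by (cases "b n = c * sqrt (2 * ln (real n))") auto
      then have "c < b n / sqrt (2 * ln (real n))"
        using elim by (simp add: pos_less_divide_eq)
      then show ?case using c by simp
    qed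
  next
    fix u :: real assume "1 < u"
    show "\<forall>\<^sub>F n in sequentially. b n / sqrt (2 * ln (real n)) < u"
      using centering_lhs_greater_log [OF \<open>1 < u\<close>] b eventually_shape_pos
    proof eventually_elim
      case (elim n)
      have "0 < u * sqrt (2 * ln (real n))" using elim \<open>1 < u\<close> by simp
      then have "\<not> u * sqrt (2 * ln (real n)) \<le> b n"
        using centering_lhs_strict_mono [of "\<alpha> n" "u * sqrt (2 * ln (real n))" "b n"] elim
        by (cases "b n = u * sqrt (2 * ln (real n))") auto
      then show ?case
        using elim by (simp add: pos_divide_less_eq)
    qed
  qed
  then have "b \<sim>[sequentially] (\<lambda>n. sqrt (2 * ln (real n)))"
    by (rule asymp_equivI')
  then show ?thesis
    using b unfolding centering_seq_def centering_equation_iff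
    by (intro exI conjI) (auto elim: eventually_mono)
qed

text \<open>Asymptotic equivalence counts 0/0 as 1; since \<open>sqrt (2 * log n)\<close> is
  eventually nonzero, the plain quotient converges.\<close>

lemma centering_seq_ratio:
  assumes "centering_seq \<alpha> b"
  shows "(\<lambda>n. b n / sqrt (2 * ln (real n))) \<longlonglongrightarrow> 1"
proof -
  have "\<forall>\<^sub>F n in sequentially. b n \<noteq> 0 \<or> sqrt (2 * ln (real n)) \<noteq> 0"
    using eventually_shape_pos by eventually_elim simp
  moreover have "b \<sim>[sequentially] (\<lambda>n. sqrt (2 * ln (real n)))"
    using assms by (simp add: centering_seq_def)
  ultimately show ?thesis
    by (intro asymp_equivD_strong)
qed

lemma centering_seq_pos:
  assumes "centering_seq \<alpha> b"
  shows "\<forall>\<^sub>F n in sequentially. 0 < b n"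
proof -
  have "\<forall>\<^sub>F n in sequentially. 0 < b n / sqrt (2 * ln (real n))"
    using order_tendstoD(1) [OF centering_seq_ratio [OF assms], of 0] by simp
  then show ?thesis using eventually_shape_pos
    by eventually_elim (simp add: zero_less_divide_iff)
qed

text \<open>The asymptotic region makes both sequences eventually positive, where the left-hand side
  is strictly increasing.\<close>

lemma centering_seq_unique:
  assumes "centering_seq \<alpha> b" "centering_seq \<alpha> b'"
  shows "\<forall>\<^sub>F n in sequentially. b n = b' n"
proof -
  have "\<forall>\<^sub>F n in sequentially. centering_lhs (\<alpha> n) (b n) = ln (real n)"
    "\<forall>\<^sub>F n in sequentially. centering_lhs (\<alpha> n) (b' n) = ln (real n)"
    using assms by (simp_all add: centering_seq_def centering_equation_iff)
  then show ?thesis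
    using centering_seq_pos [OF assms(1)] centering_seq_pos [OF assms(2)] eventually_shape_pos
  proof eventually_elim
    case (elim n)
    then show ?case
      using centering_lhs_strict_mono [of "\<alpha> n" "b n" "b' n"]
        centering_lhs_strict_mono [of "\<alpha> n" "b' n" "b n"]
      by (cases "b n" "b' n" rule: linorder_cases) auto
  qed
qed

subsection \<open>Convergence to the Gumbel distribution\<close>

lemma gamma_tail_prob_tendsto:
  fixes b :: "nat \<Rightarrow> real" and x :: real
  assumes b: "centering_seq \<alpha> b"
  defines "y \<equiv> \<lambda>n. \<alpha> n + b n * sqrt (\<alpha> n) + sqrt (\<alpha> n) / sqrt (2 * ln (real n)) * x"
  assumes prob: "\<And>n. 1 \<le> n \<Longrightarrow> prob_space (P n)"
    and X: "\<And>n. 1 \<le> n \<Longrightarrow> distributed (P n) lborel (X n) (\<lambda>u. ennreal (gamma_density (\<alpha> n) u))"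
  shows "(\<lambda>n. real n * (1 - measure (P n) (X n -` {..y n} \<inter> space (P n)))) \<longlonglongrightarrow> exp (- x)"
proof -
  define m q where "m n = sqrt (2 * ln (real n))" and "q n = sqrt (\<alpha> n)" for n
  \<comment> \<open>Eventually \<open>w = q * (q + b)\<close>, so \<open>w * r = q / m\<close> is
    the required scale, and \<open>\<rho>\<close> is the ratio of the shape to
    \<open>w\<close>.\<close>
  define \<rho> r w where "\<rho> n = q n / (q n + b n)" and "r n = 1 / (m n * (q n + b n))"
    and "w n = \<alpha> n + b n * q n" for n
  define Q where "Q n = real n * (w n * r n * (w n powr (\<alpha> n - 1) * exp (- w n) / Gamma (\<alpha> n)))" for n
  define J where "J n = (LBINT v. indicator {x<..} v * gamma_kernel (\<alpha> n - 1) (w n) (r n) v)" for n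
  have ev: "\<forall>\<^sub>F n in sequentially. 1 < ln (real n) \<and> 1 < \<alpha> n \<and> 0 < b n \<and> 0 < m n \<and> 0 < q n
      \<and> \<alpha> n = q n * q n \<and> 1 \<le> n"
    using eventually_shape_pos centering_seq_pos [OF b] eventually_ge_at_top [of 1]
    by eventually_elim (auto simp: m_def q_def simp del: ln_gt_zero_iff)
  have bm: "(\<lambda>n. b n / m n) \<longlonglongrightarrow> 1"
    using centering_seq_ratio [OF b] by (simp add: m_def)
  have mq: "(\<lambda>n. m n / q n) \<longlonglongrightarrow> 0"
    using sqrt_log_over_shape by (simp add: m_def q_def)
  have "filterlim m at_top sequentially"
    unfolding m_def
    by (rule filterlim_compose [OF _ ln_real_at_top, where g = "\<lambda>L. sqrt (2 * L)"]) real_asymp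
  then have im: "(\<lambda>n. inverse (m n)) \<longlonglongrightarrow> 0" by (rule tendsto_inverse_0_at_top)
  have "filterlim q at_top sequentially"
    unfolding q_def by (rule filterlim_compose [OF sqrt_at_top shape_at_top])
  then have iq: "(\<lambda>n. inverse (q n)) \<longlonglongrightarrow> 0" by (rule tendsto_inverse_0_at_top)
  have ia: "(\<lambda>n. inverse (\<alpha> n)) \<longlonglongrightarrow> 0" by (rule tendsto_inverse_0_at_top [OF shape_at_top])
  have \<rho>: "\<rho> \<longlonglongrightarrow> 1"
  proof -
    \<comment> \<open>The growth condition enters here: \<open>b / q\<close> is
      \<open>b / m\<close>, which tends to 1, times \<open>m / q\<close>, which tends to 0.\<close>
    have "(\<lambda>n. 1 / (1 + b n / m n * (m n / q n))) \<longlonglongrightarrow> 1 / (1 + 1 * 0)"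
      by (intro tendsto_intros bm mq) simp
    moreover have "\<forall>\<^sub>F n in sequentially. 1 / (1 + b n / m n * (m n / q n)) = \<rho> n"
      using ev by eventually_elim (simp add: \<rho>_def field_simps)
    ultimately show ?thesis using Lim_transform_eventually by force
  qed
  have r: "r \<longlonglongrightarrow> 0"
  proof -
    have "(\<lambda>n. inverse (m n) * inverse (q n) * \<rho> n) \<longlonglongrightarrow> 0 * 0 * 1"
      by (intro tendsto_intros im iq \<rho>)
    moreover have "\<forall>\<^sub>F n in sequentially. inverse (m n) * inverse (q n) * \<rho> n = r n"
      using ev by eventually_elim (simp add: \<rho>_def r_def divide_simps)
    ultimately show ?thesis using Lim_transform_eventually by force
  qed
  have bqr: "b n / m n * \<rho> n = b n * q n * r n" for n
    by (simp add: \<rho>_def r_def)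
  have "J \<longlonglongrightarrow> exp (- x)"
    unfolding J_def
  proof (rule gamma_kernel_tail_tendsto [OF _ r])
    show "\<forall>\<^sub>F n in sequentially. 0 \<le> \<alpha> n - 1"
      using ev by eventually_elim simp
    \<comment> \<open>Since \<open>q * r = \<rho> / m\<close>, the second-order coefficient is
      essentially \<open>(\<rho> / m)^2\<close>.\<close>
    have "(\<lambda>n. (1 - inverse (\<alpha> n)) * (\<rho> n * inverse (m n))\<^sup>2) \<longlonglongrightarrow> (1 - 0) * (1 * 0)\<^sup>2"
      by (intro tendsto_intros im ia \<rho>)
    moreover have "\<forall>\<^sub>F n in sequentially. (1 - inverse (\<alpha> n)) * (\<rho> n * inverse (m n))\<^sup>2 = (\<alpha> n - 1) * (r n)\<^sup>2"
      using ev
    proof eventually_elim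
      case (elim n)
      have "\<rho> n * inverse (m n) = q n * r n"
        by (simp add: \<rho>_def r_def divide_inverse)
      then have "(\<rho> n * inverse (m n))\<^sup>2 = \<alpha> n * (r n)\<^sup>2"
        using elim by (simp add: power2_eq_square)
      moreover have "(1 - inverse (\<alpha> n)) * \<alpha> n = \<alpha> n - 1"
      proof -
        have "\<alpha> n \<noteq> 0" using elim by linarith
        then show ?thesis by (simp add: left_diff_distrib)
      qed
      ultimately show ?case by (simp only: mult.assoc [symmetric])
    qed
    ultimately show "(\<lambda>n. (\<alpha> n - 1) * (r n)\<^sup>2) \<longlonglongrightarrow> 0"
      using Lim_transform_eventually by force
    \<comment> \<open>As \<open>w - \<alpha> = b * q\<close>, the slope is
      \<open>- r - b * q * r\<close>.\<close>
    have "(\<lambda>n. - r n - b n / m n * \<rho> n) \<longlonglongrightarrow> - 0 - 1 * 1"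
      by (intro tendsto_intros r bm \<rho>)
    moreover have "- r n - b n / m n * \<rho> n = (\<alpha> n - 1) * r n - w n * r n" for n
      unfolding bqr by (simp add: w_def algebra_simps)
    ultimately show "(\<lambda>n. (\<alpha> n - 1) * r n - w n * r n) \<longlonglongrightarrow> -1" by simp
  qed
  moreover have "Q \<longlonglongrightarrow> 1"
  proof -
    define S where "S a = Gamma a * sqrt a * exp a / a powr a" for a :: real
    have "(\<lambda>n. S (\<alpha> n)) \<longlonglongrightarrow> sqrt (2 * pi)"
      unfolding S_def by (rule filterlim_compose [OF Gamma_Stirling_real shape_at_top])
    then have "(\<lambda>n. sqrt (2 * pi) / S (\<alpha> n) * (b n / m n * \<rho> n)) \<longlonglongrightarrow> sqrt (2 * pi) / sqrt (2 * pi) * (1 * 1)"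
      by (intro tendsto_intros bm \<rho>) auto
    moreover have "\<forall>\<^sub>F n in sequentially. centering_equation (\<alpha> n) n (b n)"
      using b by (simp add: centering_seq_def)
    with ev have "\<forall>\<^sub>F n in sequentially. sqrt (2 * pi) / S (\<alpha> n) * (b n / m n * \<rho> n) = Q n"
    proof eventually_elim
      case (elim n)
      define a where "a = \<alpha> n"
      have a: "0 < a" using elim by (simp add: a_def)
      have w0: "0 < w n" using elim by (simp add: w_def add_pos_pos)
      \<comment> \<open>The factor \<open>w\<close> of the Jacobian raises the power to
        \<open>a\<close>, as in the centering equation.\<close>
      have "w n * w n powr (a - 1) = w n powr a"
        using w0 by (simp add: powr_diff)
      then have "Q n = (real n * (w n powr a * exp (- w n))) * r n / Gamma a"
        by (simp add: Q_def a_def)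
      also have "real n * (w n powr a * exp (- w n)) = a powr a * exp (- a) * b n * sqrt (2 * pi)"
        unfolding w_def q_def a_def using elim by (intro centering_prefactor_eq) auto
      also have "\<dots> * r n / Gamma a = sqrt (2 * pi) * (a powr a * exp (- a) / (Gamma a * q n)) * (b n * q n * r n)"
        using elim by simp
      also have "a powr a * exp (- a) / (Gamma a * q n) = 1 / S a"
        unfolding S_def q_def a_def by (simp add: exp_minus divide_inverse)
      also have "b n * q n * r n = b n / m n * \<rho> n"
        by (simp only: bqr)
      finally show ?case by (simp add: a_def)
    qed
    ultimately show ?thesis using Lim_transform_eventually by force
  qed
  ultimately have "(\<lambda>n. Q n * J n) \<longlonglongrightarrow> 1 * exp (- x)" by (intro tendsto_mult)
  moreover have "\<forall>\<^sub>F n in sequentially.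
      Q n * J n = real n * (1 - measure (P n) (X n -` {..y n} \<inter> space (P n)))"
    using ev
  proof eventually_elim
    case (elim n)
    interpret prob_space "P n" using prob elim by simp
    have pos: "0 < \<alpha> n" "0 < w n" "0 < r n" using elim by (auto simp: w_def r_def add_pos_pos)
    have "w n * r n = q n / m n"
    proof -
      have "w n = q n * (q n + b n)" using elim by (simp add: w_def algebra_simps)
      then show ?thesis using elim by (simp add: r_def)
    qed
    then have "y n = w n + w n * r n * x"
      by (simp add: y_def w_def q_def m_def)
    then show ?case
      using gamma_tail_prob [OF X pos, of x] elim by (simp add: Q_def J_def)
  qed
  ultimately show ?thesis using Lim_transform_eventually by force
qed

end


section \<open>The maximum of independent variables and the final limit\<close>

lemma (in prob_space) prob_Max_indep_le:
  fixes Y :: "nat \<Rightarrow> 'a \<Rightarrow> real"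
  assumes indep: "indep_vars (\<lambda>_. borel) Y {1..n}" and n: "1 \<le> n"
    and M: "\<And>\<omega>. \<omega> \<in> space M \<Longrightarrow> Z \<omega> = Max ((\<lambda>i. Y i \<omega>) ` {1..n})"
  shows "prob (Z -` {..y} \<inter> space M) = (\<Prod>i\<in>{1..n}. prob (Y i -` {..y} \<inter> space M))"
proof -
  have "Z -` {..y} \<inter> space M = (\<Inter>i\<in>{1..n}. Y i -` {..y} \<inter> space M)"
    using n by (auto simp: M)
  then show ?thesis
    using indep_varsD [OF indep, of "{1..n}" "\<lambda>_. {..y}"] n by simp
qed

theorem theorem2p1:
  fixes \<alpha> :: "nat \<Rightarrow> real"
    and P :: "nat \<Rightarrow> 'a measure"
    and Y :: "nat \<Rightarrow> nat \<Rightarrow> 'a \<Rightarrow> real"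
    and M :: "nat \<Rightarrow> 'a \<Rightarrow> real"
  assumes alpha_pos: "\<And>n. n \<ge> 1 \<Longrightarrow> \<alpha> n > 0"
    and prob: "\<And>n. n \<ge> 1 \<Longrightarrow> prob_space (P n)"
    and indep: "\<And>n. n \<ge> 1 \<Longrightarrow> prob_space.indep_vars (P n) (\<lambda>_. borel) (Y n) {1..n}"
    and gamma: "\<And>n i. n \<ge> 1 \<Longrightarrow> i \<in> {1..n} \<Longrightarrow>
                  distributed (P n) lborel (Y n i) (\<lambda>u. ennreal (gamma_density (\<alpha> n) u))"
    and M_max: "\<And>n \<omega>. n \<ge> 1 \<Longrightarrow> \<omega> \<in> space (P n) \<Longrightarrow> M n \<omega> = Max ((\<lambda>i. Y n i \<omega>) ` {1..n})"
    and growth: "filterlim (\<lambda>n. \<alpha> n / ln (real n)) at_top sequentially"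
  shows "(\<exists>b. centering_seq \<alpha> b) \<and>
         (\<forall>b b'. centering_seq \<alpha> b \<longrightarrow> centering_seq \<alpha> b' \<longrightarrow> (\<forall>\<^sub>F n in sequentially. b n = b' n)) \<and>
         (\<forall>b. centering_seq \<alpha> b \<longrightarrow>
            weak_conv_m
              (\<lambda>n. distr (P n) borel
                 (\<lambda>\<omega>. sqrt (2 * ln (real n) / \<alpha> n) * (M n \<omega> - \<alpha> n - b n * sqrt (\<alpha> n))))
              gumbel)"
proof (intro conjI allI impI)
  show "\<exists>b. centering_seq \<alpha> b"
    by (rule centering_seq_exists [OF growth])
  show "\<forall>\<^sub>F n in sequentially. b n = b' n" if "centering_seq \<alpha> b" "centering_seq \<alpha> b'" for b b'
    by (rule centering_seq_unique [OF growth that])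
  fix b assume b: "centering_seq \<alpha> b"
  let ?Z = "\<lambda>n \<omega>. sqrt (2 * ln (real n) / \<alpha> n) * (M n \<omega> - \<alpha> n - b n * sqrt (\<alpha> n))"
  show "weak_conv_m (\<lambda>n. distr (P n) borel (?Z n)) gumbel"
    unfolding weak_conv_m_def weak_conv_def
  proof (intro allI impI)
    fix x
    define y where "y n = \<alpha> n + b n * sqrt (\<alpha> n) + sqrt (\<alpha> n) / sqrt (2 * ln (real n)) * x" for n
    \<comment> \<open>The first variable of each row represents the common law.\<close>
    define p where "p n = 1 - measure (P n) (Y n 1 -` {..y n} \<inter> space (P n))" for n
    have "(\<lambda>n. real n * p n) \<longlonglongrightarrow> exp (- x)"
      unfolding p_def y_def
      by (rule gamma_tail_prob_tendsto [OF growth b]) (use prob gamma in auto)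
    then have "(\<lambda>n. (1 - p n) ^ n) \<longlonglongrightarrow> exp (- exp (- x))"
      by (rule tendsto_one_minus_power)
    moreover have "\<forall>\<^sub>F n in sequentially. (1 - p n) ^ n = cdf (distr (P n) borel (?Z n)) x"
      using eventually_shape_pos [OF growth] eventually_ge_at_top [of 1]
    proof eventually_elim
      case (elim n)
      interpret prob_space "P n" using prob elim by simp
      have Y_meas: "Y n i \<in> borel_measurable (P n)" if "i \<in> {1..n}" for i
        using distributed_measurable [OF gamma [OF elim(2) that]] by simp
      have "(\<lambda>\<omega>. Max ((\<lambda>i. Y n i \<omega>) ` {1..n})) \<in> borel_measurable (P n)"
        using elim(2) Y_meas by (intro borel_measurable_Max) auto
      then have [measurable]: "M n \<in> borel_measurable (P n)"
        using M_max [OF elim(2)] by (simp cong: measurable_cong)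
      define m q where "m = sqrt (2 * ln (real n))" and "q = sqrt (\<alpha> n)"
      have mq: "0 < m" "0 < q" using elim by (auto simp: m_def q_def simp del: ln_gt_zero_iff)
      have "?Z n \<omega> \<le> x \<longleftrightarrow> M n \<omega> \<le> y n" for \<omega>
      proof -
        have "?Z n \<omega> \<le> x \<longleftrightarrow> m / q * (M n \<omega> - \<alpha> n - b n * q) \<le> x"
          by (simp add: m_def q_def real_sqrt_divide)
        also have "\<dots> \<longleftrightarrow> M n \<omega> - \<alpha> n - b n * q \<le> q / m * x"
          using mq by (simp add: field_simps)
        also have "\<dots> \<longleftrightarrow> M n \<omega> \<le> y n"
          by (auto simp: y_def m_def q_def)
        finally show ?thesis .
      qed
      then have "?Z n -` {..x} \<inter> space (P n) = M n -` {..y n} \<inter> space (P n)"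
        by auto
      then have "cdf (distr (P n) borel (?Z n)) x = prob (M n -` {..y n} \<inter> space (P n))"
        unfolding cdf_def by (subst measure_distr) auto
      also have "\<dots> = (\<Prod>i\<in>{1..n}. prob (Y n i -` {..y n} \<inter> space (P n)))"
        using indep M_max elim by (intro prob_Max_indep_le) auto
      also have "\<dots> = (\<Prod>i\<in>{1..n}. 1 - p n)"
      proof (intro prod.cong refl)
        fix i assume i: "i \<in> {1..n}"
        \<comment> \<open>Variables with the same density have the same pushforward, so all factors
          of the product agree.\<close>
        have "measure (distr (P n) lborel (Y n i)) {..y n} = measure (distr (P n) lborel (Y n 1)) {..y n}"
          using gamma [OF elim(2) i] gamma [OF elim(2), of 1] elim(2)
          by (simp add: distributed_distr_eq_density)
        then show "prob (Y n i -` {..y n} \<inter> space (P n)) = 1 - p n"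
          using Y_meas i elim(2) by (simp add: measure_distr p_def)
      qed
      finally show ?case by simp
    qed
    ultimately show "(\<lambda>n. cdf (distr (P n) borel (?Z n)) x) \<longlonglongrightarrow> cdf gumbel x"
      unfolding cdf_gumbel by (rule Lim_transform_eventually)
  qed
qed

end
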